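(* Let $d\ge 1$, let $A$ be a finite alphabet, let $F:A^{\mathbb{Z}^d}\to A^{\mathbb{Z}^d}$ be a surjective cellular automaton, and let $\mu$ be the uniform Bernoulli measure on $A^{\mathbb{Z}^d}$. If $\mu(Q_n)=1$ for all $n\in\mathbb{N}$, then $F$ has no measurable irrational eigenvalue.
   Context: A cellular automaton is a map $F:A^{\mathbb{Z}^d}\to A^{\mathbb{Z}^d}$ of the form $F(x)_{m}=f(x_{m+K})$ for all $m\in\mathbb{Z}^d$, with $K\subset\mathbb{Z}^d$ finite and $f:A^{K}\to A$. The uniform Bernoulli measure $\mu$ is the product of the uniform probability measures on $A$, on the sigma-algebra generated by cylinder sets; it is $F$-invariant when $F$ is surjective. For $n\in\mathbb{N}$, $$Q_n=\{x\in A^{\mathbb{Z}^d}:\exists m\in\mathbb{N},\ \exists p\ge1,\ \forall i\in\mathbb{N},\ F^{m+ip}(x)|_{[-n,n]^d}=F^m(x)|_{[-n,n]^d}\text{, the sequence }(F^{j}(x)|_{[-n,n]^d})_{j\in\mathbb{N}}\text{ being eventually periodic}\},$$ i.e. $Q_n$ is the set of $x$ for which $(F^{j}(x)|_{[-n,n]^d})_{j\in\mathbb{N}}$ is eventually periodic. A complex number $\lambda=e^{2\pi i\alpha}$, $\alpha\in\mathbb{R}$, is a measurable eigenvalue of $F$ if there is a measurable $g:A^{\mathbb{Z}^d}\to\mathbb{C}$, not $\mu$-almost everywhere zero, with $g\circ F=\lambda g$ $\mu$-almost everywhere; it is irrational if $\alpha$ is irrational. *)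

theory Defs
  imports "HOL-Probability.Probability"
begin

text \<open>
  The lattice of rank \<open>d\<close> is the type \<^typ>\<open>int ^ 'd\<close> with \<open>d = CARD('d)\<close>, which is at least 1 since
  types are nonempty; the alphabet is a type of class \<^class>\<open>finite\<close>.
\<close>

type_synonym ('a, 'd) config = "int ^ 'd \<Rightarrow> 'a"

text \<open>A local rule on \<open>A\<^sup>K\<close> is a function on all configurations that is only ever applied to
  configurations restricted to \<open>K\<close>.\<close>

definition cellular_automaton ::
    "(('a::finite, 'd::finite) config \<Rightarrow> ('a, 'd) config) \<Rightarrow> bool" where
  "cellular_automaton F \<longleftrightarrow>
     (\<exists>(K :: (int ^ 'd) set) (f :: ('a, 'd) config \<Rightarrow> 'a).
        finite K \<and> (\<forall>x m. F x m = f (restrict (\<lambda>k. x (m + k)) K)))"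

definition bernoulli :: "('a::finite, 'd::finite) config measure" where
  "bernoulli = PiM UNIV (\<lambda>_. uniform_count_measure UNIV)"

definition cube :: "nat \<Rightarrow> (int ^ 'd::finite) set" where
  "cube n = {m. \<forall>i. - int n \<le> m $ i \<and> m $ i \<le> int n}"

definition eventually_periodic :: "(nat \<Rightarrow> 'b) \<Rightarrow> bool" where
  "eventually_periodic s \<longleftrightarrow> (\<exists>m. \<exists>p\<ge>1. \<forall>j\<ge>m. s (j + p) = s j)"

definition Q ::
    "(('a::finite, 'd::finite) config \<Rightarrow> ('a, 'd) config) \<Rightarrow> nat \<Rightarrow> ('a, 'd) config set" where
  "Q F n = {x. eventually_periodic (\<lambda>j. restrict ((F ^^ j) x) (cube n))}"

definition measurable_eigenvalue :: "'b measure \<Rightarrow> ('b \<Rightarrow> 'b) \<Rightarrow> complex \<Rightarrow> bool" where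
  "measurable_eigenvalue M T l \<longleftrightarrow>
     (\<exists>\<alpha>::real. l = exp (2 * of_real pi * \<i> * of_real \<alpha>)) \<and>
     (\<exists>g \<in> borel_measurable M.
        \<not> (AE x in M. g x = 0) \<and> (AE x in M. g (T x) = l * g x))"

text \<open>The angle \<open>\<alpha>\<close> is determined by the eigenvalue up to an integer, so its irrationality does not
  depend on the choice.\<close>

definition irrational_eigenvalue :: "'b measure \<Rightarrow> ('b \<Rightarrow> 'b) \<Rightarrow> complex \<Rightarrow> bool" where
  "irrational_eigenvalue M T l \<longleftrightarrow>
     measurable_eigenvalue M T l \<and>
     (\<exists>\<alpha>::real. \<alpha> \<notin> \<rat> \<and> l = exp (2 * of_real pi * \<i> * of_real \<alpha>))"

end

theory Submission
  imports Defs
begin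

text \<open>
  Suppose that \<open>g \<circ> F = l * g\<close> almost everywhere, where \<open>l\<close> has modulus one and
  is no root of unity. Normalising, one may assume that \<open>g\<close> is bounded. The claim is that
  \<open>g\<close> integrates to zero over every set \<open>V\<close> that depends on finitely many cells only;
  such sets generate the \<open>\<sigma>\<close>-algebra, so \<open>g\<close> then vanishes almost everywhere
  (\<open>AE_eq_0_if_integral_determined_eq_0\<close>).

  Suppose for the moment that \<open>F\<close> preserves the measure. Then the integral of \<open>g\<close> over
  \<open>V\<close> is unchanged if the integrand is composed with \<open>F ^^ j\<close>; averaging over
  \<open>j < N\<close> and applying the eigenvalue equation, it is the integral of \<open>g\<close> times the averages of
  \<open>l ^ j * indicator V ((F ^^ j) x)\<close>. If \<open>V\<close> depends on the cells of the cube of radius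
  \<open>n\<close>, then the sequence \<open>indicator V ((F ^^ j) x)\<close> is eventually periodic for
  \<open>x\<close> in \<open>Q F n\<close>, that is, almost surely. Its frequencies are roots of unity, so it does
  not correlate with \<open>l ^ j\<close> and the averages tend to zero
  (\<open>LIMSEQ_Cesaro_twisted_periodic\<close>). Dominated convergence gives the claim
  (\<open>integral_eigenfunction_eq_0\<close>).

  The other ingredient is that a surjective cellular automaton preserves the uniform Bernoulli measure
  (\<open>distr_surj_cellular_automaton\<close>). Surjectivity bounds the number of patterns of a preimage from
  below, up to an error that comes from the boundary of the window; applying this bound to many independent translates
  of the same event makes the error disappear (\<open>measure_le_measure_vimage\<close>).
\<close>

section \<open>Configurations seen through finitely many cells\<close>

definition determined_on :: "'i set \<Rightarrow> ('i \<Rightarrow> 'a) set \<Rightarrow> bool" where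
  "determined_on C V \<longleftrightarrow> (\<forall>x y. (\<forall>c\<in>C. x c = y c) \<longrightarrow> x \<in> V \<longrightarrow> y \<in> V)"

text \<open>A set determined on \<open>C\<close> is recovered from its patterns on \<open>C\<close>. For finite \<open>C\<close>, questions about
  measures of such sets thus become questions about counting patterns.\<close>

definition patterns :: "'i set \<Rightarrow> ('i \<Rightarrow> 'a) set \<Rightarrow> ('i \<Rightarrow> 'a) set" where
  "patterns C V = (\<lambda>x. restrict x C) ` V"

definition translate :: "int ^ 'd \<Rightarrow> ('a, 'd::finite) config \<Rightarrow> ('a, 'd) config" where
  "translate t x = (\<lambda>m. x (t + m))"

lemma determined_on_mono: "determined_on C V \<Longrightarrow> C \<subseteq> D \<Longrightarrow> determined_on D V"
  unfolding determined_on_def by blast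

lemma determined_on_Compl: "determined_on C V \<Longrightarrow> determined_on C (- V)"
  unfolding determined_on_def by (metis ComplD ComplI)

lemma determined_on_Int:
  "determined_on C V \<Longrightarrow> determined_on D W \<Longrightarrow> determined_on (C \<union> D) (V \<inter> W)"
  unfolding determined_on_def by blast

lemma restrict_in_patterns_iff:
  assumes "determined_on C V"
  shows "restrict x C \<in> patterns C V \<longleftrightarrow> x \<in> V"
proof
  assume "restrict x C \<in> patterns C V"
  then obtain y where "y \<in> V" "restrict y C = restrict x C" unfolding patterns_def by auto
  moreover from this have "\<forall>c\<in>C. y c = x c" by (metis restrict_apply')
  ultimately show "x \<in> V" using assms unfolding determined_on_def by blast
qed (auto simp: patterns_def)

lemma finite_patterns:
  fixes V :: "('i \<Rightarrow> 'a::finite) set"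
  assumes "finite C"
  shows "finite (patterns C V)"
proof (rule finite_subset)
  show "patterns C V \<subseteq> PiE C (\<lambda>_. UNIV)" unfolding patterns_def by auto
  show "finite (PiE C (\<lambda>_. UNIV :: 'a set))" using assms by (simp add: finite_PiE)
qed

lemma determined_on_translate:
  fixes V :: "('a, 'd::finite) config set"
  assumes "determined_on C V"
  shows "determined_on ((+) t ` C) (translate t -` V)"
  unfolding determined_on_def
proof (intro allI impI)
  fix x y :: "('a, 'd) config"
  assume "\<forall>c\<in>(+) t ` C. x c = y c" and x: "x \<in> translate t -` V"
  then have "\<forall>c\<in>C. translate t x c = translate t y c" by (auto simp: translate_def)
  with x show "y \<in> translate t -` V" using assms unfolding determined_on_def by blast
qed

section \<open>The uniform Bernoulli measure on sets determined on finitely many cells\<close>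

interpretation coordinates: product_prob_space "\<lambda>_. uniform_count_measure (UNIV :: 'a::finite set)"
    "UNIV :: (int ^ 'd::finite) set"
  by (simp add: prob_space_uniform_count_measure product_prob_spaceI)

lemma prob_space_bernoulli: "prob_space (bernoulli :: ('a::finite, 'd::finite) config measure)"
  unfolding bernoulli_def by (rule coordinates.prob_space_axioms)

interpretation bernoulli: prob_space "bernoulli :: ('a::finite, 'd::finite) config measure"
  by (rule prob_space_bernoulli)

lemma space_bernoulli [simp]: "space bernoulli = UNIV"
  unfolding bernoulli_def space_PiM by (auto simp: space_uniform_count_measure)

lemma cylinder_eq_emb:
  fixes w :: "('a::finite, 'd::finite) config"
  assumes "w \<in> extensional C"
  shows "{x. restrict x C = w} =
    prod_emb UNIV (\<lambda>_. uniform_count_measure UNIV) C (PiE C (\<lambda>c. {w c}))"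
  using assms unfolding prod_emb_def
  by (auto simp: space_uniform_count_measure extensional_def PiE_def Pi_def fun_eq_iff restrict_def)

lemma
  fixes w :: "('a::finite, 'd::finite) config"
  assumes "finite C" "w \<in> extensional C"
  shows sets_cylinder: "{x. restrict x C = w} \<in> sets bernoulli"
    and measure_cylinder: "measure bernoulli {x. restrict x C = w} = 1 / real CARD('a) ^ card C"
proof -
  show "{x. restrict x C = w} \<in> sets bernoulli"
    unfolding cylinder_eq_emb[OF assms(2)] bernoulli_def
    by (rule sets_PiM_I) (use assms in \<open>auto simp: sets_uniform_count_measure\<close>)
  show "measure bernoulli {x. restrict x C = w} = 1 / real CARD('a) ^ card C"
    unfolding cylinder_eq_emb[OF assms(2)] bernoulli_def
    by (subst coordinates.measure_PiM_emb)
       (use assms in \<open>auto simp: sets_uniform_count_measure measure_uniform_count_measure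
         power_one_over\<close>)
qed

text \<open>A set determined on \<open>C\<close> is the disjoint union of the cylinders of its patterns, and the
  measure is uniform, so every cylinder over \<open>C\<close> weighs the same. Independence and translation
  invariance below, and the key inequality for surjective automata, are read off from this
  counting formula.\<close>

lemma
  fixes V :: "('a::finite, 'd::finite) config set"
  assumes "finite C" "determined_on C V"
  shows sets_determined: "V \<in> sets bernoulli"
    and measure_determined:
      "measure bernoulli V = real (card (patterns C V)) / real CARD('a) ^ card C"
proof -
  have V: "V = (\<Union>w\<in>patterns C V. {x. restrict x C = w})"
    using restrict_in_patterns_iff[OF assms(2)] by auto
  have ext: "w \<in> extensional C" if "w \<in> patterns C V" for w
    using that unfolding patterns_def by auto
  have fin: "finite (patterns C V)" using assms(1) by (rule finite_patterns)
  show "V \<in> sets bernoulli"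
    by (subst V) (use fin ext sets_cylinder[OF assms(1)] in blast)
  have "measure bernoulli V = (\<Sum>w\<in>patterns C V. measure bernoulli {x. restrict x C = w})"
    by (subst V, rule bernoulli.finite_measure_finite_Union)
       (use fin ext sets_cylinder[OF assms(1)] in \<open>auto simp: disjoint_family_on_def\<close>)
  also have "\<dots> = (\<Sum>w\<in>patterns C V. 1 / real CARD('a) ^ card C)"
    by (intro sum.cong refl measure_cylinder assms ext)
  finally show "measure bernoulli V = real (card (patterns C V)) / real CARD('a) ^ card C"
    by simp
qed

lemma measure_translate:
  fixes V :: "('a::finite, 'd::finite) config set"
  assumes "finite C" "determined_on C V"
  shows "measure bernoulli (translate t -` V) = measure bernoulli V"
proof -
  let ?D = "(+) t ` C"
  have "bij_betw (\<lambda>w. restrict (\<lambda>c. w (c - t)) ?D) (patterns C V) (patterns ?D (translate t -` V))"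
  proof (rule bij_betw_byWitness[where f' = "\<lambda>w. restrict (\<lambda>c. w (t + c)) C"])
    show "(\<lambda>w. restrict (\<lambda>c. w (c - t)) ?D) ` patterns C V \<subseteq> patterns ?D (translate t -` V)"
    proof clarify
      fix w assume "w \<in> patterns C V"
      then obtain x where x: "x \<in> V" "w = restrict x C" unfolding patterns_def by auto
      have "translate (- t) x \<in> translate t -` V" using x by (simp add: translate_def)
      moreover have "restrict (\<lambda>c. w (c - t)) ?D = restrict (translate (- t) x) ?D"
        by (rule restrict_ext) (auto simp: x translate_def)
      ultimately show "restrict (\<lambda>c. w (c - t)) ?D \<in> patterns ?D (translate t -` V)"
        unfolding patterns_def by auto
    qed
    show "(\<lambda>w. restrict (\<lambda>c. w (t + c)) C) ` patterns ?D (translate t -` V) \<subseteq> patterns C V"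
    proof clarify
      fix w assume "w \<in> patterns ?D (translate t -` V)"
      then obtain x where x: "translate t x \<in> V" "w = restrict x ?D" unfolding patterns_def by auto
      have "restrict (\<lambda>c. w (t + c)) C = restrict (translate t x) C"
        by (rule restrict_ext) (auto simp: x translate_def)
      with x show "restrict (\<lambda>c. w (t + c)) C \<in> patterns C V"
        unfolding patterns_def by auto
    qed
  qed (auto simp: patterns_def fun_eq_iff)
  then have "card (patterns ?D (translate t -` V)) = card (patterns C V)"
    by (simp add: bij_betw_same_card)
  moreover have "card ?D = card C" by (simp add: card_image)
  ultimately show ?thesis
    using measure_determined[OF assms] assms
      measure_determined[OF _ determined_on_translate[OF assms(2)], of t] by simp
qed

text \<open>Independence of disjoint windows: a pattern on \<open>C \<union> D\<close> is a pair of patterns, one on each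
  window, and the two can be chosen freely.\<close>

lemma measure_Int_disjoint_determined:
  fixes V W :: "('a::finite, 'd::finite) config set"
  assumes V: "finite C" "determined_on C V" and W: "finite D" "determined_on D W"
    and disj: "C \<inter> D = {}"
  shows "measure bernoulli (V \<inter> W) = measure bernoulli V * measure bernoulli W"
proof -
  let ?g = "\<lambda>w. (restrict w C, restrict w D)"
  have "bij_betw ?g (patterns (C \<union> D) (V \<inter> W)) (patterns C V \<times> patterns D W)"
  proof (rule bij_betw_byWitness[where
        f' = "\<lambda>(v, w). restrict (\<lambda>c. if c \<in> C then v c else w c) (C \<union> D)"])
    show "?g ` patterns (C \<union> D) (V \<inter> W) \<subseteq> patterns C V \<times> patterns D W"
      unfolding patterns_def by (auto simp: Int_absorb1)
    show "(\<lambda>(v, w). restrict (\<lambda>c. if c \<in> C then v c else w c) (C \<union> D)) `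
        (patterns C V \<times> patterns D W) \<subseteq> patterns (C \<union> D) (V \<inter> W)"
    proof clarify
      fix v w assume "v \<in> patterns C V" "w \<in> patterns D W"
      then obtain x y where x: "x \<in> V" "v = restrict x C" and y: "y \<in> W" "w = restrict y D"
        unfolding patterns_def by auto
      let ?z = "\<lambda>c. if c \<in> C then x c else y c"
      have "?z \<in> V" using V(2)[unfolded determined_on_def, rule_format, of x ?z] x(1) by simp
      moreover have "?z \<in> W" using W(2)[unfolded determined_on_def, rule_format, of y ?z] y(1) disj
        by (simp add: disjoint_iff) metis
      moreover have "restrict (\<lambda>c. if c \<in> C then v c else w c) (C \<union> D) = restrict ?z (C \<union> D)"
        by (rule restrict_ext) (auto simp: x y)
      ultimately show "restrict (\<lambda>c. if c \<in> C then v c else w c) (C \<union> D)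
          \<in> patterns (C \<union> D) (V \<inter> W)"
        unfolding patterns_def by auto
    qed
  qed (use disj in \<open>auto simp: patterns_def fun_eq_iff\<close>)
  then have "card (patterns (C \<union> D) (V \<inter> W)) = card (patterns C V) * card (patterns D W)"
    by (simp add: bij_betw_same_card card_cartesian_product)
  then show ?thesis
    using measure_determined[OF V] measure_determined[OF W] V W disj
      measure_determined[OF _ determined_on_Int[OF V(2) W(2)]]
    by (simp add: card_Un_disjoint power_add)
qed

lemma determined_on_all_translates:
  fixes V :: "('a, 'd::finite) config set"
  assumes "determined_on C V"
  shows "determined_on (\<Union>t\<in>T. (+) t ` C) {x. \<forall>t\<in>T. translate t x \<in> V}"
  unfolding determined_on_def
proof (intro allI impI, clarify)
  fix x y :: "('a, 'd) config" and t
  assume eq: "\<forall>c\<in>\<Union>t\<in>T. (+) t ` C. x c = y c" and x: "\<forall>t\<in>T. translate t x \<in> V" and t: "t \<in> T"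
  have "\<forall>c\<in>C. translate t x c = translate t y c" using eq t by (auto simp: translate_def)
  then show "translate t y \<in> V" using x t assms unfolding determined_on_def by blast
qed

lemma measure_all_translates:
  fixes V :: "('a::finite, 'd::finite) config set"
  assumes V: "finite C" "determined_on C V" and T: "finite T"
    and "disjoint_family_on (\<lambda>t. (+) t ` C) T"
  shows "measure bernoulli {x. \<forall>t\<in>T. translate t x \<in> V} = measure bernoulli V ^ card T"
  using T assms(4)
proof (induction T rule: finite_induct)
  case empty
  then show ?case using bernoulli.prob_space by simp
next
  case (insert t T)
  have dis: "((+) t ` C) \<inter> (\<Union>t\<in>T. (+) t ` C) = {}"
    using insert.prems by (simp add: disjoint_family_on_insert[OF insert.hyps(2)])
  have "{x. \<forall>t\<in>insert t T. translate t x \<in> V} = translate t -` V \<inter> {x. \<forall>t\<in>T. translate t x \<in> V}"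
    by auto
  moreover have "measure bernoulli {x. \<forall>t\<in>T. translate t x \<in> V} = measure bernoulli V ^ card T"
    using insert.IH insert.prems by (simp add: disjoint_family_on_insert[OF insert.hyps(2)])
  ultimately show ?case
    using measure_Int_disjoint_determined[OF _ determined_on_translate[OF V(2)] _
        determined_on_all_translates[OF V(2)] dis] V insert.hyps measure_translate[OF V]
    by simp
qed

section \<open>Cubes\<close>

lemma card_cube: "card (cube n :: (int ^ 'd::finite) set) = (2 * n + 1) ^ CARD('d)"
proof -
  have "bij_betw vec_nth (cube n :: (int ^ 'd) set) (PiE UNIV (\<lambda>_. {- int n..int n}))"
    by (rule bij_betw_byWitness[where f' = vec_lambda]) (auto simp: cube_def PiE_def)
  then have "card (cube n :: (int ^ 'd) set) = card (PiE (UNIV :: 'd set) (\<lambda>_. {- int n..int n}))"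
    by (rule bij_betw_same_card)
  also have "\<dots> = (2 * n + 1) ^ CARD('d)" by (simp add: card_PiE nat_add_distrib nat_mult_distrib)
  finally show ?thesis .
qed

lemma finite_cube [simp]: "finite (cube n :: (int ^ 'd::finite) set)"
  by (rule card_ge_0_finite) (simp add: card_cube)

lemma cube_iff: "m \<in> cube n \<longleftrightarrow> (\<forall>i. \<bar>m $ i\<bar> \<le> int n)"
  unfolding cube_def by (auto simp: abs_le_iff minus_le_iff)

lemma add_in_cube: "a \<in> cube m \<Longrightarrow> b \<in> cube n \<Longrightarrow> a + b \<in> cube (m + n)"
  unfolding cube_iff by (auto intro: order_trans[OF abs_triangle_ineq add_mono])

lemma finite_subset_cube:
  assumes "finite (K :: (int ^ 'd::finite) set)"
  obtains n where "K \<subseteq> cube n"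
proof
  show "K \<subseteq> cube (nat (\<Sum>k\<in>K. \<Sum>i\<in>UNIV. \<bar>k $ i\<bar>))"
  proof
    fix m assume m: "m \<in> K"
    have "\<bar>m $ j\<bar> \<le> (\<Sum>k\<in>K. \<Sum>i\<in>UNIV. \<bar>k $ i\<bar>)" for j
    proof -
      have "\<bar>m $ j\<bar> \<le> (\<Sum>i\<in>UNIV. \<bar>m $ i\<bar>)" by (rule member_le_sum) auto
      also have "\<dots> \<le> (\<Sum>k\<in>K. \<Sum>i\<in>UNIV. \<bar>k $ i\<bar>)"
        by (rule member_le_sum[OF m]) (auto simp: assms sum_nonneg)
      finally show ?thesis .
    qed
    then show "m \<in> cube (nat (\<Sum>k\<in>K. \<Sum>i\<in>UNIV. \<bar>k $ i\<bar>))"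
      unfolding cube_iff by (metis int_nat_eq nat_0_le abs_ge_zero order_trans)
  qed
qed

section \<open>Surjective cellular automata preserve the uniform Bernoulli measure\<close>

lemma cellular_automaton_memory:
  fixes F :: "('a::finite, 'd::finite) config \<Rightarrow> ('a, 'd) config"
  assumes "cellular_automaton F"
  obtains r where "\<And>n V. determined_on (cube n) V \<Longrightarrow> determined_on (cube (n + r)) (F -` V)"
    and "\<And>t x. F (translate t x) = translate t (F x)"
    and "\<And>n x y. (\<forall>m\<in>cube (n + r). x m = y m) \<Longrightarrow> (\<forall>m\<in>cube n. F x m = F y m)"
proof -
  obtain K f where K: "finite K" and F: "\<And>x m. F x m = f (restrict (\<lambda>k. x (m + k)) K)"
    using assms unfolding cellular_automaton_def by blast
  obtain r where r: "K \<subseteq> cube r" using finite_subset_cube[OF K] .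
  have local: "\<forall>m\<in>cube n. F x m = F y m" if eq: "\<forall>m\<in>cube (n + r). x m = y m" for n x y
  proof
    fix m :: "int ^ 'd" assume m: "m \<in> cube n"
    have "restrict (\<lambda>k. x (m + k)) K = restrict (\<lambda>k. y (m + k)) K"
      by (rule restrict_ext) (use eq add_in_cube[OF m] r in blast)
    then show "F x m = F y m" unfolding F by simp
  qed
  show thesis
  proof (rule that[of r])
    show "determined_on (cube (n + r)) (F -` V)" if "determined_on (cube n) V" for n V
      using that local unfolding determined_on_def by (metis vimage_eq)
    show "F (translate t x) = translate t (F x)" for t x
      by (rule ext) (simp add: F translate_def add.assoc)
  qed (rule local)
qed

text \<open>The growth of a cube of side about \<open>a * k\<close> per cell of a cube of side \<open>2 * k + 1\<close>. The limit does
  not depend on \<open>b\<close>, which says that the boundary of a large cube is negligible.\<close>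

lemma LIMSEQ_boundary_ratio:
  fixes a b :: real
  shows "(\<lambda>k. ((a * real k + b) / (2 * real k + 1)) ^ d) \<longlonglongrightarrow> (a / 2) ^ d"
proof -
  have "(\<lambda>k. inverse (2 * real k + 1)) \<longlonglongrightarrow> 0"
    using LIMSEQ_subseq_LIMSEQ[OF LIMSEQ_inverse_real_of_nat, of "\<lambda>k. 2 * k"]
    by (simp add: strict_mono_def o_def add.commute)
  then have *: "(\<lambda>k. a / 2 + (b - a / 2) * inverse (2 * real k + 1)) \<longlonglongrightarrow> a / 2 + (b - a / 2) * 0"
    by (intro tendsto_intros)
  have "(a * real k + b) / (2 * real k + 1) = a / 2 + (b - a / 2) * inverse (2 * real k + 1)" for k
    by (simp add: field_simps)
  with * have "(\<lambda>k. (a * real k + b) / (2 * real k + 1)) \<longlonglongrightarrow> a / 2" by simp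
  then show ?thesis by (rule tendsto_power)
qed

text \<open>By surjectivity, every pattern of \<open>G\<close> on the cube of radius \<open>n\<close> is the image of some pattern on
  the cube of radius \<open>n + r\<close>, so the preimage has at least as many patterns as \<open>G\<close>. In terms of
  measures this loses a factor exponential in the size of the boundary layer.\<close>

lemma measure_le_measure_vimage_boundary:
  fixes F :: "('a::finite, 'd::finite) config \<Rightarrow> ('a, 'd) config"
  assumes surj: "surj F"
    and dep: "\<And>n x y. (\<forall>m\<in>cube (n + r). x m = y m) \<Longrightarrow> (\<forall>m\<in>cube n. F x m = F y m)"
    and G: "determined_on (cube n) G" and FG: "determined_on (cube (n + r)) (F -` G)"
  shows "measure bernoulli G * real CARD('a) ^ card (cube n :: (int ^ 'd) set)
    \<le> measure bernoulli (F -` G) * real CARD('a) ^ card (cube (n + r) :: (int ^ 'd) set)"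
proof -
  let ?M = "cube n :: (int ^ 'd) set" and ?B = "cube (n + r) :: (int ^ 'd) set"
  have "patterns ?M G \<subseteq> (\<lambda>w. restrict (F w) ?M) ` patterns ?B (F -` G)"
  proof
    fix v assume "v \<in> patterns ?M G"
    then obtain y where y: "y \<in> G" "v = restrict y ?M" unfolding patterns_def by auto
    obtain x where x: "y = F x" using surj by (metis surjD)
    have "\<forall>m\<in>?M. F x m = F (restrict x ?B) m" by (rule dep) simp
    then have "v = restrict (F (restrict x ?B)) ?M" using x y by (auto simp: fun_eq_iff)
    moreover have "restrict x ?B \<in> patterns ?B (F -` G)"
      using x y unfolding patterns_def by auto
    ultimately show "v \<in> (\<lambda>w. restrict (F w) ?M) ` patterns ?B (F -` G)" by blast
  qed
  then have "card (patterns ?M G) \<le> card (patterns ?B (F -` G))"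
    by (rule surj_card_le[OF finite_patterns[OF finite_cube]])
  then show ?thesis
    using measure_determined[OF _ G] measure_determined[OF _ FG] by simp
qed

lemma dilate_add_in_cube:
  fixes s c :: "int ^ 'd::finite"
  assumes "s \<in> cube k" "c \<in> cube n"
  shows "int L *s s + c \<in> cube (L * k + n)"
proof (rule add_in_cube[OF _ assms(2)])
  show "int L *s s \<in> cube (L * k)"
    using assms(1) unfolding cube_iff by (auto simp: abs_mult mult_left_mono)
qed

lemma disjoint_translates_dilate:
  fixes S :: "(int ^ 'd::finite) set"
  assumes "L > 2 * n"
  shows "inj_on ((*s) (int L)) S"
    and "disjoint_family_on (\<lambda>t. (+) t ` cube n) ((*s) (int L) ` S)"
proof -
  let ?l = "(*s) (int L) :: int ^ 'd \<Rightarrow> int ^ 'd"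
  \<comment> \<open>Taking \<open>c = c'\<close> gives injectivity, and arbitrary \<open>c\<close> and \<open>c'\<close> give disjointness.\<close>
  have eq: "s = s'" if "?l s + c = ?l s' + c'" "c \<in> cube n" "c' \<in> cube n" for s s' c c'
  proof -
    have "s $ i = s' $ i" for i
    proof -
      have e: "int L * (s $ i - s' $ i) = c' $ i - c $ i"
        using that(1) by (auto simp: vec_eq_iff algebra_simps)
      have "\<bar>c $ i\<bar> \<le> int n" "\<bar>c' $ i\<bar> \<le> int n" using that(2,3) by (simp_all add: cube_iff)
      then have "\<bar>c' $ i - c $ i\<bar> < int L" using assms by linarith
      then have "\<bar>s $ i - s' $ i\<bar> < 1"
        using assms unfolding e[symmetric] abs_mult by (simp add: mult_less_cancel_left1)
      then show ?thesis by simp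
    qed
    then show ?thesis by (simp add: vec_eq_iff)
  qed
  show "inj_on ?l S" using eq[of _ 0 _ 0] by (intro inj_onI) (auto simp: cube_iff)
  show "disjoint_family_on (\<lambda>t. (+) t ` cube n) (?l ` S)"
    unfolding disjoint_family_on_def using eq by blast
qed

text \<open>The boundary factor is removed by a tensor power trick. Instead of \<open>V\<close> itself, consider the
  event \<open>G\<close> that \<open>V\<close> occurs at every site of a dilated cube \<open>T k\<close>. The spacing \<open>L\<close> is so large that
  the windows of \<open>V\<close>, and also those of the preimage of \<open>V\<close>, are disjoint; hence the measures of \<open>G\<close> and of
  its preimage are the powers with exponent \<open>card (T k)\<close> of those of \<open>V\<close> and its preimage. After
  taking the root of that order, the boundary contributes the exponent \<open>b k / card (T k)\<close>, which
  tends to \<open>0\<close>: boundary grows more slowly than volume.\<close>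

lemma measure_le_measure_vimage:
  fixes F :: "('a::finite, 'd::finite) config \<Rightarrow> ('a, 'd) config"
  assumes ca: "cellular_automaton F" and surj: "surj F" and V: "determined_on (cube n) V"
  shows "measure bernoulli V \<le> measure bernoulli (F -` V)"
proof -
  obtain r where FV: "\<And>n V. determined_on (cube n) V \<Longrightarrow> determined_on (cube (n + r)) (F -` V)"
    and comm: "\<And>t x. F (translate t x) = translate t (F x)"
    and dep: "\<And>n x y. (\<forall>m\<in>cube (n + r). x m = y m) \<Longrightarrow> (\<forall>m\<in>cube n. F x m = F y m)"
    by (rule cellular_automaton_memory[OF ca]) (rule that)
  define L where "L = 2 * (n + r) + 1"
  define T :: "nat \<Rightarrow> (int ^ 'd) set" where "T k = (*s) (int L) ` cube k" for k
  define b where "b k = real (card (cube (L * k + n + r) :: (int ^ 'd) set))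
    - real (card (cube (L * k + n) :: (int ^ 'd) set))" for k
  have cT: "card (T k) = (2 * k + 1) ^ CARD('d)" for k
    unfolding T_def
    by (subst card_image[OF disjoint_translates_dilate(1)[of "n + r"]])
       (simp_all add: card_cube L_def)
  have disj: "disjoint_family_on (\<lambda>t. (+) t ` cube m) (T k)" if "m \<le> n + r" for m k
    unfolding T_def by (rule disjoint_translates_dilate(2)) (use that L_def in auto)
  have main: "measure bernoulli V \<le>
      measure bernoulli (F -` V) * real CARD('a) powr (b k / real (card (T k)))" for k
  proof -
    let ?G = "{x. \<forall>t\<in>T k. translate t x \<in> V}"
    have G: "determined_on (cube (L * k + n)) ?G"
      by (rule determined_on_mono[OF determined_on_all_translates[OF V]])
         (auto simp: T_def intro: dilate_add_in_cube)
    have FG_eq: "F -` ?G = {x. \<forall>t\<in>T k. translate t x \<in> F -` V}"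
      by (simp add: comm)
    have "measure bernoulli ?G * real CARD('a) ^ card (cube (L * k + n) :: (int ^ 'd) set)
      \<le> measure bernoulli (F -` ?G) *
          real CARD('a) ^ card (cube (L * k + n + r) :: (int ^ 'd) set)"
      by (rule measure_le_measure_vimage_boundary[OF surj dep G FV[OF G]])
    moreover have "measure bernoulli ?G = measure bernoulli V ^ card (T k)"
      by (rule measure_all_translates[OF _ V _ disj]) (auto simp: T_def)
    moreover have "measure bernoulli (F -` ?G) = measure bernoulli (F -` V) ^ card (T k)"
      unfolding FG_eq
      by (rule measure_all_translates[OF _ FV[OF V] _ disj]) (auto simp: T_def)
    ultimately have "measure bernoulli V ^ card (T k)
      \<le> measure bernoulli (F -` V) ^ card (T k) * real CARD('a) powr b k"
      by (simp add: b_def powr_diff powr_realpow field_simps)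
    also have "\<dots> = (measure bernoulli (F -` V) *
        real CARD('a) powr (b k / real (card (T k)))) ^ card (T k)"
      by (simp add: power_mult_distrib powr_power cT)
    finally show ?thesis by (subst (asm) power_mono_iff) (simp_all add: cT)
  qed
  have ratio: "b k / real (card (T k)) =
     ((2 * real L * real k + (2 * real n + 2 * real r + 1)) / (2 * real k + 1)) ^ CARD('d)
     - ((2 * real L * real k + (2 * real n + 1)) / (2 * real k + 1)) ^ CARD('d)" for k
    unfolding b_def cT card_cube by (simp add: power_divide diff_divide_distrib algebra_simps)
  have "(\<lambda>k. b k / real (card (T k))) \<longlonglongrightarrow>
      (2 * real L / 2) ^ CARD('d) - (2 * real L / 2) ^ CARD('d)"
    unfolding ratio by (intro tendsto_diff LIMSEQ_boundary_ratio)
  then have "(\<lambda>k. b k / real (card (T k))) \<longlonglongrightarrow> 0" by simp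
  then have "(\<lambda>k. measure bernoulli (F -` V) * real CARD('a) powr (b k / real (card (T k))))
      \<longlonglongrightarrow> measure bernoulli (F -` V) * real CARD('a) powr 0"
    by (intro tendsto_intros) auto
  then show ?thesis using main by (intro LIMSEQ_le_const) auto
qed

lemma measurable_cellular_automaton:
  fixes F :: "('a::finite, 'd::finite) config \<Rightarrow> ('a, 'd) config"
  assumes ca: "cellular_automaton F"
  shows "F \<in> measurable bernoulli bernoulli"
proof -
  obtain r where FV: "\<And>n V. determined_on (cube n) V \<Longrightarrow> determined_on (cube (n + r)) (F -` V)"
    by (rule cellular_automaton_memory[OF ca]) (rule that)
  have "(\<lambda>x. F x m) \<in> measurable bernoulli (uniform_count_measure UNIV)" for m
  proof (rule measurableI)
    fix A :: "'a set"
    obtain n where n: "{m} \<subseteq> cube n" using finite_subset_cube[of "{m}"] by auto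
    have "determined_on (cube n) {x. x m \<in> A}" using n by (auto simp: determined_on_def)
    then have "F -` {x. x m \<in> A} \<in> sets bernoulli"
      by (intro sets_determined[OF _ FV]) auto
    then show "(\<lambda>x. F x m) -` A \<inter> space bernoulli \<in> sets bernoulli"
      by (simp add: vimage_def)
  qed (simp add: space_uniform_count_measure)
  then have "(\<lambda>x. \<lambda>m\<in>UNIV. F x m) \<in> measurable bernoulli bernoulli"
    unfolding bernoulli_def by (intro measurable_restrict)
  then show ?thesis by (simp add: restrict_def)
qed

text \<open>The cubes exhaust the lattice, so the sets determined on a cube include the product cylinders,
  which form a generating \<open>\<pi>\<close>-system.\<close>

lemma bernoulli_eqI:
  fixes P :: "('a::finite, 'd::finite) config measure"
  assumes "finite_measure P" "sets P = sets bernoulli"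
    and eq: "\<And>n V. determined_on (cube n) V \<Longrightarrow> emeasure P V = emeasure bernoulli V"
  shows "P = bernoulli"
  unfolding bernoulli_def
proof (rule measure_eqI_PiM_infinite)
  fix J :: "(int ^ 'd) set" and A :: "int ^ 'd \<Rightarrow> 'a set" assume J: "finite J"
  let ?V = "prod_emb UNIV (\<lambda>_. uniform_count_measure UNIV) J (Pi\<^sub>E J A)"
  obtain n where "J \<subseteq> cube n" using finite_subset_cube[OF J] .
  moreover have "determined_on J ?V"
    unfolding determined_on_def prod_emb_def
    by (auto simp: space_uniform_count_measure PiE_iff)
  ultimately have "determined_on (cube n) ?V" by (metis determined_on_mono)
  then show "emeasure P ?V = emeasure (PiM UNIV (\<lambda>_. uniform_count_measure UNIV)) ?V"
    using eq unfolding bernoulli_def by blast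
qed (use assms in \<open>auto simp: bernoulli_def\<close>)

text \<open>Passing to the preimage does not decrease the measure of \<open>V\<close> nor that of its complement, so it
  preserves both.\<close>

lemma distr_surj_cellular_automaton:
  fixes F :: "('a::finite, 'd::finite) config \<Rightarrow> ('a, 'd) config"
  assumes ca: "cellular_automaton F" and surj: "surj F"
  shows "distr bernoulli bernoulli F = bernoulli"
proof (rule bernoulli_eqI)
  have F: "F \<in> measurable bernoulli bernoulli" by (rule measurable_cellular_automaton[OF ca])
  show "finite_measure (distr bernoulli bernoulli F)"
    using bernoulli.finite_measure_distr[OF F] .
  fix n and V :: "('a, 'd) config set" assume V: "determined_on (cube n) V"
  have Vs: "V \<in> sets bernoulli" by (rule sets_determined[OF _ V]) simp
  have FVs: "F -` V \<in> sets bernoulli" using measurable_sets[OF F Vs] by simp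
  have "measure bernoulli (- V) \<le> measure bernoulli (- (F -` V))"
    using measure_le_measure_vimage[OF ca surj determined_on_Compl[OF V]] by (simp add: vimage_Compl)
  then have "measure bernoulli (F -` V) \<le> measure bernoulli V"
    using bernoulli.prob_compl[OF Vs] bernoulli.prob_compl[OF FVs] by (simp add: Compl_eq_Diff_UNIV)
  with measure_le_measure_vimage[OF ca surj V]
  have "measure bernoulli (F -` V) = measure bernoulli V" by simp
  then show "emeasure (distr bernoulli bernoulli F) V = emeasure bernoulli V"
    by (simp add: emeasure_distr[OF F Vs] bernoulli.emeasure_eq_measure)
qed simp

section \<open>Eigenfunctions and eventually periodic orbits\<close>

lemma eventually_periodic_comp:
  "eventually_periodic s \<Longrightarrow> eventually_periodic (\<lambda>j. f (s j))"
  unfolding eventually_periodic_def by metis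

text \<open>Multiplying by \<open>l ^ j\<close> turns period \<open>p\<close> into the relation \<open>a (j + p) = l ^ p * a j\<close>
  with \<open>l ^ p \<noteq> 1\<close>. Hence \<open>a\<close> is from some index on the difference sequence of a bounded sequence
  \<open>D\<close>, so its partial sums are bounded and its averages vanish in the limit.\<close>

lemma LIMSEQ_Cesaro_twisted_periodic:
  fixes s :: "nat \<Rightarrow> complex"
  assumes l: "norm l = 1" "\<And>p. p \<ge> 1 \<Longrightarrow> l ^ p \<noteq> 1"
    and s: "eventually_periodic s" "\<And>j. norm (s j) \<le> 1"
  shows "(\<lambda>N. (\<Sum>j<N. l ^ j * s j) / of_nat N) \<longlonglongrightarrow> 0"
proof -
  obtain m p where p: "p \<ge> 1" and per: "\<And>j. j \<ge> m \<Longrightarrow> s (j + p) = s j"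
    using s(1) unfolding eventually_periodic_def by blast
  define a where "a j = l ^ j * s j" for j
  have a_per: "a (j + p) = l ^ p * a j" if "j \<ge> m" for j
    using per[OF that] by (simp add: a_def power_add)
  have a_le: "norm (a j) \<le> 1" for j using s(2) l(1) by (simp add: a_def norm_mult norm_power)
  have lp: "l ^ p - 1 \<noteq> 0" using l(2)[OF p] by simp
  define D where "D j = (\<Sum>i<p. a (j + i)) / (l ^ p - 1)" for j
  have D_Suc: "D (Suc j) - D j = a j" if "j \<ge> m" for j
  proof -
    have "(\<Sum>i<p. a (Suc j + i)) - (\<Sum>i<p. a (j + i)) = a (j + p) - a j"
      using sum_lessThan_telescope[of "\<lambda>i. a (j + i)" p] by (simp add: sum_subtractf)
    also have "\<dots> = (l ^ p - 1) * a j" using a_per[OF that] by (simp add: algebra_simps)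
    finally show ?thesis using lp unfolding D_def diff_divide_distrib[symmetric] by simp
  qed
  have D_le: "norm (D j) \<le> real p / norm (l ^ p - 1)" for j
    unfolding D_def norm_divide
    by (intro divide_right_mono sum_norm_bound[of "{..<p}" _ 1, simplified] a_le) simp
  define c where "c = norm (\<Sum>j<m. a j) + 2 * (real p / norm (l ^ p - 1))"
  have bound: "norm (\<Sum>j<N. a j) \<le> c" if "N \<ge> m" for N
  proof -
    have "(\<Sum>j<N. a j) = (\<Sum>j<m. a j) + (D N - D m)"
      using that by (induction N rule: dec_induct) (simp_all add: D_Suc[symmetric])
    also have "norm \<dots> \<le> norm (\<Sum>j<m. a j) + (norm (D N) + norm (D m))"
      by (intro norm_triangle_le add_left_mono norm_triangle_ineq4)
    finally show ?thesis using D_le[of N] D_le[of m] unfolding c_def by linarith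
  qed
  show ?thesis
  proof (rule Lim_null_comparison)
    show "\<forall>\<^sub>F N in sequentially. norm ((\<Sum>j<N. l ^ j * s j) / of_nat N) \<le> c / real N"
      using eventually_ge_at_top[of m]
      by eventually_elim (use bound in \<open>simp add: a_def norm_divide divide_right_mono\<close>)
    show "(\<lambda>N. c / real N) \<longlonglongrightarrow> 0" by (rule lim_const_over_n)
  qed
qed

text \<open>By invariance and the eigenvalue equation, the integral \<open>I\<close> of \<open>g\<close> over \<open>V\<close> equals the integral of
  \<open>g x * (l ^ j * indicator V ((T ^^ j) x))\<close> for every \<open>j\<close>, hence also that of \<open>g\<close> times the
  average \<open>A N\<close> of the second factor over \<open>j < N\<close>. Almost every orbit visits \<open>V\<close> in an eventually
  periodic way, so these averages tend to \<open>0\<close> almost everywhere.\<close>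

lemma (in prob_space) integral_eigenfunction_eq_0:
  fixes g :: "'a \<Rightarrow> complex"
  assumes T: "T \<in> measurable M M" "distr M M T = M"
    and g: "g \<in> borel_measurable M" "\<And>x. norm (g x) \<le> 1" "AE x in M. g (T x) = l * g x"
    and l: "norm l = 1" "\<And>p. p \<ge> 1 \<Longrightarrow> l ^ p \<noteq> 1"
    and V: "V \<in> sets M" "AE x in M. eventually_periodic (\<lambda>j. (T ^^ j) x \<in> V)"
  shows "(\<integral>x. g x * indicator V x \<partial>M) = 0"
proof -
  note [measurable] = T(1) g(1) V(1)
  define I where "I = (\<integral>x. g x * indicator V x \<partial>M)"
  have Tj [measurable]: "T ^^ j \<in> measurable M M" for j
    by (induction j) (auto intro: measurable_comp[OF _ T(1)] simp: id_def)
  have Tj_inv: "distr M M (T ^^ j) = M" for j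
  proof (induction j)
    case 0
    then show ?case by (simp add: id_def distr_id)
  next
    case (Suc j)
    have "distr M M (T ^^ Suc j) = distr (distr M M (T ^^ j)) M T"
      by (subst distr_distr) simp_all
    then show ?case using Suc T(2) by metis
  qed
  have gT: "AE x in M. g ((T ^^ j) x) = l ^ j * g x" for j
  proof (induction j)
    case (Suc j)
    have "AE x in M. g (T ((T ^^ j) x)) = l * g ((T ^^ j) x)"
      by (rule AE_distrD[OF Tj]) (unfold Tj_inv, rule g(3))
    with Suc show ?case by eventually_elim simp
  qed simp
  have I_j: "I = (\<integral>x. g x * (l ^ j * indicator V ((T ^^ j) x)) \<partial>M)" for j
  proof -
    have "I = (\<integral>x. g ((T ^^ j) x) * indicator V ((T ^^ j) x) \<partial>M)"
      unfolding I_def by (subst (1) Tj_inv[of j, symmetric], subst integral_distr) auto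
    also have "\<dots> = (\<integral>x. g x * (l ^ j * indicator V ((T ^^ j) x)) \<partial>M)"
      by (rule integral_cong_AE) (use gT[of j] in auto)
    finally show ?thesis .
  qed
  have int: "integrable M (\<lambda>x. g x * (l ^ j * indicator V ((T ^^ j) x)))" for j
    by (rule integrable_const_bound[where B = 1])
       (use g(2) l(1) in \<open>auto simp: norm_mult norm_power indicator_def\<close>)
  define A where "A N x = (\<Sum>j<N. l ^ j * indicator V ((T ^^ j) x)) / of_nat N" for N x
  have [measurable]: "(\<lambda>x. A N x) \<in> borel_measurable M" for N
    unfolding A_def by measurable
  have I_N: "(\<integral>x. g x * A N x \<partial>M) = I" if "N > 0" for N
  proof -
    have "(\<integral>x. g x * A N x \<partial>M) =
        (\<integral>x. (\<Sum>j<N. g x * (l ^ j * indicator V ((T ^^ j) x))) / of_nat N \<partial>M)"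
      unfolding A_def by (simp only: times_divide_eq_right sum_distrib_left)
    also have "\<dots> = (\<Sum>j<N. I) / of_nat N"
      using int by (simp add: I_j[symmetric])
    finally show ?thesis using that by simp
  qed
  have "(\<lambda>N. \<integral>x. g x * A N x \<partial>M) \<longlonglongrightarrow> (\<integral>x. 0 \<partial>M)"
  proof (rule integral_dominated_convergence[where w = "\<lambda>_. 1"])
    show "AE x in M. (\<lambda>N. g x * A N x) \<longlonglongrightarrow> 0"
      using V(2)
    proof eventually_elim
      case (elim x)
      have per: "eventually_periodic (\<lambda>j. indicator V ((T ^^ j) x) :: complex)"
        using eventually_periodic_comp[OF elim, of of_bool] by (simp add: indicator_def of_bool_def)
      have "(\<lambda>N. A N x) \<longlonglongrightarrow> 0"
        unfolding A_def
        by (rule LIMSEQ_Cesaro_twisted_periodic[OF l(1) _ per])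
           (simp_all add: l(2) indicator_def)
      then show ?case by (rule tendsto_mult_right_zero)
    qed
    show "AE x in M. norm (g x * A N x) \<le> 1" for N
    proof (rule AE_I2)
      fix x
      have "norm (\<Sum>j<N. l ^ j * indicator V ((T ^^ j) x)) \<le> real N"
        by (rule sum_norm_bound[of "{..<N}" _ 1, simplified])
           (use l(1) in \<open>simp add: norm_mult norm_power indicator_def\<close>)
      then have "norm (A N x) \<le> 1"
        unfolding A_def norm_divide norm_of_nat
        by (cases "N = 0") (simp_all add: divide_le_eq_1)
      then show "norm (g x * A N x) \<le> 1"
        using g(2)[of x] by (simp add: norm_mult mult_le_one)
    qed
  qed simp_all
  then have "(\<lambda>N. \<integral>x. g x * A N x \<partial>M) \<longlonglongrightarrow> 0" by simp
  moreover have "(\<lambda>N. \<integral>x. g x * A N x \<partial>M) \<longlonglongrightarrow> I"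
    by (rule tendsto_eventually, rule eventually_mono[OF eventually_gt_at_top[of 0]], rule I_N)
  ultimately show ?thesis unfolding I_def by (rule LIMSEQ_unique[symmetric])
qed

text \<open>As \<open>1 + h\<close> is nonnegative, it is the density of a measure. This measure agrees with the Bernoulli
  measure on the sets determined on cubes, hence everywhere, and densities are unique.\<close>

lemma AE_eq_0_if_integral_determined_eq_0:
  fixes h :: "('a::finite, 'd::finite) config \<Rightarrow> real"
  assumes h: "h \<in> borel_measurable bernoulli" "\<And>x. \<bar>h x\<bar> \<le> 1"
    and zero: "\<And>n V. determined_on (cube n) V \<Longrightarrow> (\<integral>x. h x * indicator V x \<partial>bernoulli) = 0"
  shows "AE x in bernoulli. h x = 0"
proof -
  note [measurable] = h(1)
  have pos: "0 \<le> 1 + h x" for x using h(2)[of x] by linarith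
  have eq: "emeasure (density bernoulli (\<lambda>x. ennreal (1 + h x))) V = emeasure bernoulli V"
    if V: "determined_on (cube n) V" for n V
  proof -
    have [measurable]: "V \<in> sets bernoulli" by (rule sets_determined[OF _ V]) simp
    have int: "integrable bernoulli (\<lambda>x. h x * indicator V x)"
      by (rule bernoulli.integrable_const_bound[where B = 1])
         (use h(2) in \<open>auto simp: indicator_def\<close>)
    have "emeasure (density bernoulli (\<lambda>x. ennreal (1 + h x))) V
        = (\<integral>\<^sup>+x. ennreal (indicator V x + h x * indicator V x) \<partial>bernoulli)"
      by (subst emeasure_density) (auto intro!: nn_integral_cong simp: indicator_def)
    also have "\<dots> = ennreal (\<integral>x. indicator V x + h x * indicator V x \<partial>bernoulli)"
    proof (rule nn_integral_eq_integral)
      show "integrable bernoulli (\<lambda>x. indicator V x + h x * indicator V x)"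
        using int by (intro Bochner_Integration.integrable_add)
          (simp_all add: bernoulli.emeasure_eq_measure)
    qed (use pos in \<open>auto simp: indicator_def\<close>)
    also have "(\<integral>x. indicator V x + h x * indicator V x \<partial>bernoulli) = measure bernoulli V"
      using int zero[OF V] by (subst Bochner_Integration.integral_add)
        (auto simp: bernoulli.emeasure_eq_measure)
    finally show ?thesis by (simp add: bernoulli.emeasure_eq_measure)
  qed
  have "emeasure (density bernoulli (\<lambda>x. ennreal (1 + h x))) UNIV
      = emeasure (bernoulli :: ('a, 'd) config measure) UNIV"
    by (rule eq) (simp add: determined_on_def)
  then have fin: "finite_measure (density bernoulli (\<lambda>x. ennreal (1 + h x)))"
    by (intro finite_measureI) (simp add: bernoulli.emeasure_eq_measure)
  have "density bernoulli (\<lambda>x. ennreal (1 + h x)) = density bernoulli (\<lambda>_. 1)"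
    using bernoulli_eqI[OF fin _ eq] by (simp add: density_1)
  then have "AE x in bernoulli. ennreal (1 + h x) = 1"
    by (subst (asm) sigma_finite_density_unique)
       (use fin in \<open>auto simp: density_1 intro: finite_measure.axioms(1)\<close>)
  then show ?thesis
    by eventually_elim (use pos in \<open>simp add: ennreal_eq_1\<close>)
qed

section \<open>Absence of irrational eigenvalues\<close>

lemma irrational_rotation_power_neq_1:
  fixes \<alpha> :: real
  assumes "\<alpha> \<notin> \<rat>" "p \<ge> 1"
  shows "exp (2 * of_real pi * \<i> * of_real \<alpha>) ^ p \<noteq> 1"
proof
  assume "exp (2 * of_real pi * \<i> * of_real \<alpha>) ^ p = 1"
  then have "exp (of_nat p * (2 * of_real pi * \<i> * of_real \<alpha>)) = 1" by (simp add: exp_of_nat_mult)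
  then obtain n :: int where "real p * (2 * pi * \<alpha>) = of_int (2 * n) * pi"
    by (auto simp: exp_eq_1)
  then have "\<alpha> = of_int n / of_nat p" using assms(2) by (simp add: field_simps)
  then show False using assms(1) by simp
qed

lemma complex_indicator: "Re (indicator V x) = indicator V x" "Im (indicator V x) = 0"
  by (simp_all add: indicator_def)

theorem lemma14:
  fixes F :: "('a::finite, 'd::finite) config \<Rightarrow> ('a, 'd) config"
  assumes "cellular_automaton F"
    and "surj F"
    and "\<forall>n. measure bernoulli (Q F n) = 1"
  shows "\<not> (\<exists>l. irrational_eigenvalue bernoulli F l)"
proof clarify
  fix l assume "irrational_eigenvalue bernoulli F l"
  then obtain \<alpha> :: real and g where \<alpha>: "\<alpha> \<notin> \<rat>" and l_eq: "l = exp (2 * of_real pi * \<i> * of_real \<alpha>)"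
    and g: "g \<in> borel_measurable bernoulli" "\<not> (AE x in bernoulli. g x = 0)"
      "AE x in bernoulli. g (F x) = l * g x"
    unfolding irrational_eigenvalue_def measurable_eigenvalue_def by blast
  have l: "norm l = 1" "\<And>p. p \<ge> 1 \<Longrightarrow> l ^ p \<noteq> 1"
    using irrational_rotation_power_neq_1[OF \<alpha>] by (simp_all add: l_eq)
  \<comment> \<open>Normalising keeps the eigenvalue equation, since \<open>l\<close> has modulus one, and makes the
    eigenfunction bounded and hence integrable.\<close>
  define u where "u x = sgn (g x)" for x
  have u: "u \<in> borel_measurable bernoulli" "\<And>x. norm (u x) \<le> 1"
      "AE x in bernoulli. u (F x) = l * u x"
  proof -
    show "u \<in> borel_measurable bernoulli"
      unfolding u_def sgn_div_norm using g(1) by measurable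
    show "norm (u x) \<le> 1" for x by (simp add: u_def norm_sgn)
    show "AE x in bernoulli. u (F x) = l * u x"
      using g(3) by eventually_elim (use l(1) in \<open>simp add: u_def sgn_mult sgn_div_norm[of l]\<close>)
  qed
  note F = measurable_cellular_automaton[OF assms(1)] distr_surj_cellular_automaton[OF assms(1,2)]
  have zero: "(\<integral>x. u x * indicator V x \<partial>bernoulli) = 0" if V: "determined_on (cube n) V" for n V
  proof (rule bernoulli.integral_eigenfunction_eq_0[OF F u l])
    show "V \<in> sets bernoulli" by (rule sets_determined[OF _ V]) simp
    have "AE x in bernoulli. x \<in> Q F n" using assms(3) by (intro bernoulli.AE_prob_1) simp
    then show "AE x in bernoulli. eventually_periodic (\<lambda>j. (F ^^ j) x \<in> V)"
    proof eventually_elim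
      case (elim x)
      then have "eventually_periodic (\<lambda>j. restrict ((F ^^ j) x) (cube n) \<in> patterns (cube n) V)"
        unfolding Q_def by (auto dest: eventually_periodic_comp)
      then show ?case by (simp add: restrict_in_patterns_iff[OF V])
    qed
  qed
  have int: "integrable bernoulli (\<lambda>x. u x * indicator V x)" if "determined_on (cube n) V" for n V
    by (rule bernoulli.integrable_const_bound[where B = 1])
       (use u sets_determined[OF _ that] in \<open>auto simp: norm_mult indicator_def\<close>)
  have "AE x in bernoulli. Re (u x) = 0"
  proof (rule AE_eq_0_if_integral_determined_eq_0)
    show "(\<integral>x. Re (u x) * indicator V x \<partial>bernoulli) = 0" if V: "determined_on (cube n) V" for n V
      using integral_Re[OF int[OF V]] zero[OF V] by (simp add: complex_indicator)
  qed (use u abs_Re_le_cmod order_trans in \<open>auto, blast\<close>)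
  moreover have "AE x in bernoulli. Im (u x) = 0"
  proof (rule AE_eq_0_if_integral_determined_eq_0)
    show "(\<integral>x. Im (u x) * indicator V x \<partial>bernoulli) = 0" if V: "determined_on (cube n) V" for n V
      using integral_Im[OF int[OF V]] zero[OF V] by (simp add: complex_indicator)
  qed (use u abs_Im_le_cmod order_trans in \<open>auto, blast\<close>)
  ultimately have "AE x in bernoulli. g x = 0"
  proof eventually_elim
    case (elim x)
    then have "u x = 0" by (simp add: complex_eq_iff)
    then show ?case by (simp add: u_def sgn_zero_iff)
  qed
  with g(2) show False by contradiction
qed

end
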